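(* Let $X$ and $Y$ be Banach spaces, let $\Gamma$ be an arbitrary set, let $E$ be an invariant sequence space over $X$, and for every $l\in\Gamma$ let $F_l$ be a strongly invariant sequence space over $\mathbb{K}$. If $f\colon X\to Y$ is strongly compatible with $F_l^w(Y)$ for all $l\in\Gamma$, then the set $$G^w(E,f,(F_l)_{l\in\Gamma})=\left\{(x_j)_{j=1}^\infty\in E:\ (f(x_j))_{j=1}^\infty\notin\bigcup_{l\in\Gamma}F_l^w(Y)\right\}$$ is either empty or spaceable in $E$.
   Context: All Banach spaces are nonzero and are over the same scalar field $\mathbb{K}=\mathbb{R}$ or $\mathbb{C}$; $Y'$ denotes the topological dual of $Y$. For a Banach space $X\neq\{0\}$ and $x\in X^{\mathbb{N}}$, define $x^0$ as follows: if $x$ has only finitely many non-zero coordinates, then $x^0=0$; otherwise $x^0=(x_j)_{j=1}^\infty$, where $x_j$ is the $j$-th non-zero coordinate of $x$. An invariant sequence space over $X$ is an infinite-dimensional Banach or quasi-Banach space $E$ of $X$-valued sequences (with coordinatewise vector operations) such that: (b1) for $x\in X^{\mathbb{N}}$ with $x^0\ne0$, $x\in E$ if and only if $x^0\in E$, and in that case $\|x\|\le K\|x^0\|$ for some constant $K$ depending only on $E$; (b2) $\|x_j\|\le\|x\|$ for every $x=(x_j)_{j=1}^\infty\in E$ and every $j\in\mathbb{N}$. An invariant sequence space $E$ over $X$ is called strongly invariant if (a) $c_{00}(X)\subset E$, where $c_{00}(X)$ is the space of $X$-valued sequences with only finitely many non-zero coordinates; and (b) $(x_j)_{j=1}^\infty\in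 E$ if and only if all subsequences of $(x_j)_{j=1}^\infty$ also belong to $E$. (These notions are applied with $\mathbb{K}$ in place of $X$ for the spaces $F_l$.) For an invariant sequence space $F$ over $\mathbb{K}$ and a Banach space $Y$, define $$F^w(Y)=\{(x_j)_{j=1}^\infty\in Y^{\mathbb{N}}:\ (\varphi(x_j))_{j=1}^\infty\in F\text{ for all }\varphi\in Y'\}.$$ If $F$ is an invariant sequence space over $\mathbb{K}$, a map $g\colon X\to\mathbb{K}$ with $g(0)=0$ is compatible with $F$ if for any sequence $(x_j)_{j=1}^\infty$ of elements of $X$ and any scalar $a\ne0$, $(g(x_j))_{j=1}^\infty\notin F$ implies $(g(ax_j))_{j=1}^\infty\notin F$. A map $f\colon X\to Y$ with $f(0)=0$ (not assumed linear or continuous) is strongly compatible with $F^w(Y)$ if $\varphi\circ f$ is compatible with $F$ for all continuous linear functionals $\varphi\colon Y\to\mathbb{K}$. A subset $A$ of $E$ is spaceable in $E$ if $A\cup\{0\}$ contains a closed infinite-dimensional linear subspace of $E$. *)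

theory Defs
  imports "HOL-Analysis.Analysis" "HOL-Library.Function_Algebras" "HOL-Library.Infinite_Set"
begin

text \<open>
  The scalar field is a type of sort \<open>{real_normed_field, banach}\<close>. The norm of such a field
  is multiplicative, so by the Gelfand--Mazur theorem these are exactly the isometric copies of
  the real and the complex numbers.

  The library has no class of complex Banach spaces, so the scalar multiplication is a parameter.
  By additivity and continuity it necessarily extends the operation \<open>scaleR\<close> of the type.
\<close>

locale banach_space_over = vector_space sc
  for sc :: "'k::{real_normed_field,banach} \<Rightarrow> 'a::banach \<Rightarrow> 'a" +
  assumes norm_scale: "norm (sc c x) = norm c * norm x"
    and nonzero_space: "\<exists>x::'a. x \<noteq> 0"

definition topological_dual ::
    "('k::{real_normed_field,banach} \<Rightarrow> 'a::banach \<Rightarrow> 'a) \<Rightarrow> ('a \<Rightarrow> 'k) set" where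
  "topological_dual sc =
     {\<phi>. Vector_Spaces.linear sc (*) \<phi> \<and> continuous_on UNIV \<phi>}"

text \<open>
  Sequences are functions on \<^typ>\<open>nat\<close>, so coordinates are numbered from 0; their addition and
  zero are the pointwise ones of \<^theory>\<open>HOL-Library.Function_Algebras\<close>.
\<close>

definition seq_scale :: "('k \<Rightarrow> 'a \<Rightarrow> 'a) \<Rightarrow> 'k \<Rightarrow> (nat \<Rightarrow> 'a) \<Rightarrow> (nat \<Rightarrow> 'a)" where
  "seq_scale sc c x = (\<lambda>j. sc c (x j))"

definition zero_free :: "(nat \<Rightarrow> 'a::zero) \<Rightarrow> (nat \<Rightarrow> 'a)" where
  "zero_free x =
     (if finite {j. x j \<noteq> 0} then (\<lambda>j. 0) else (\<lambda>j. x (enumerate {j. x j \<noteq> 0} j)))"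

definition c00 :: "(nat \<Rightarrow> 'a::zero) set" where
  "c00 = {x. finite {j. x j \<noteq> 0}}"

definition infinite_dimensional ::
    "('k::field \<Rightarrow> 'v::ab_group_add \<Rightarrow> 'v) \<Rightarrow> 'v set \<Rightarrow> bool" where
  "infinite_dimensional sc V \<longleftrightarrow> \<not> (\<exists>B. finite B \<and> module.span sc B = V)"

text \<open>
  The topology on \<open>E\<close> defined by a quasi-norm \<open>N\<close>. Since \<open>N\<close> need not be continuous, the sets
  \<open>{y. N (y - x) < e}\<close> are neighbourhoods of \<open>x\<close> but need not be open.
\<close>

definition quasi_norm_topology :: "'v::ab_group_add set \<Rightarrow> ('v \<Rightarrow> real) \<Rightarrow> 'v topology" where
  "quasi_norm_topology E N =
     topology (\<lambda>U. U \<subseteq> E \<and> (\<forall>x\<in>U. \<exists>e>0. \<forall>y\<in>E. N (y - x) < e \<longrightarrow> y \<in> U))"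

lemma openin_quasi_norm_topology:
  "openin (quasi_norm_topology E N) U \<longleftrightarrow>
     U \<subseteq> E \<and> (\<forall>x\<in>U. \<exists>e>0. \<forall>y\<in>E. N (y - x) < e \<longrightarrow> y \<in> U)"
proof -
  let ?P = "\<lambda>U. U \<subseteq> E \<and> (\<forall>x\<in>U. \<exists>e>0. \<forall>y\<in>E. N (y - x) < e \<longrightarrow> y \<in> U)"
  have "?P (S \<inter> T)" if S: "?P S" and T: "?P T" for S T
  proof (intro conjI ballI)
    show "S \<inter> T \<subseteq> E" using S by blast
    fix x assume x: "x \<in> S \<inter> T"
    obtain d where d: "d > 0" "\<forall>y\<in>E. N (y - x) < d \<longrightarrow> y \<in> S"
      using S x by blast
    obtain e where e: "e > 0" "\<forall>y\<in>E. N (y - x) < e \<longrightarrow> y \<in> T"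
      using T x by blast
    show "\<exists>e>0. \<forall>y\<in>E. N (y - x) < e \<longrightarrow> y \<in> S \<inter> T"
      using d e by (intro exI[of _ "min d e"]) auto
  qed
  moreover have "?P (\<Union>\<K>)" if "\<forall>K\<in>\<K>. ?P K" for \<K>
    using that by (meson Sup_least Union_iff)
  ultimately have "istopology ?P"
    unfolding istopology_def by blast
  then show ?thesis
    unfolding quasi_norm_topology_def by (simp add: topology_inverse')
qed

text \<open>
  Quasi-Banach spaces of sequences; the Banach case is the one where \<open>C = 1\<close> is possible in
  \<open>quasi_triangle\<close>. The values of \<open>N\<close> outside \<open>E\<close> are irrelevant.
\<close>

locale quasi_banach_sequence_space =
  fixes sc :: "'k::{real_normed_field,banach} \<Rightarrow> 'a::banach \<Rightarrow> 'a"
    and E :: "(nat \<Rightarrow> 'a) set"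
    and N :: "(nat \<Rightarrow> 'a) \<Rightarrow> real"
  assumes base_space: "banach_space_over sc"
    and linear_subspace: "module.subspace (seq_scale sc) E"
    and nonneg: "x \<in> E \<Longrightarrow> N x \<ge> 0"
    and eq_zero_iff: "x \<in> E \<Longrightarrow> N x = 0 \<longleftrightarrow> x = 0"
    and homogeneous: "x \<in> E \<Longrightarrow> N (seq_scale sc c x) = norm c * N x"
    and quasi_triangle: "\<exists>C\<ge>1. \<forall>x\<in>E. \<forall>y\<in>E. N (x + y) \<le> C * (N x + N y)"
    and complete:
      "(\<And>n. u n \<in> E) \<Longrightarrow> (\<forall>e>0. \<exists>M. \<forall>m\<ge>M. \<forall>n\<ge>M. N (u m - u n) < e) \<Longrightarrow>
       \<exists>x\<in>E. (\<lambda>n. N (u n - x)) \<longlonglongrightarrow> 0"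

locale invariant_sequence_space = quasi_banach_sequence_space +
  assumes infinite_dim: "infinite_dimensional (seq_scale sc) E"
    and zero_free_invariant:
      "\<exists>K. \<forall>x. zero_free x \<noteq> 0 \<longrightarrow>
         (x \<in> E \<longleftrightarrow> zero_free x \<in> E) \<and> (x \<in> E \<longrightarrow> N x \<le> K * N (zero_free x))"
    and coordinate_le: "x \<in> E \<Longrightarrow> norm (x j) \<le> N x"

locale strongly_invariant_sequence_space = invariant_sequence_space +
  assumes c00_subset: "c00 \<subseteq> E"
    and subseq_iff: "x \<in> E \<longleftrightarrow> (\<forall>r::nat \<Rightarrow> nat. strict_mono r \<longrightarrow> x \<circ> r \<in> E)"

definition weak_space ::
    "('k::{real_normed_field,banach} \<Rightarrow> 'b::banach \<Rightarrow> 'b) \<Rightarrow> (nat \<Rightarrow> 'k) set \<Rightarrow> (nat \<Rightarrow> 'b) set" where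
  "weak_space sc F = {x. \<forall>\<phi>\<in>topological_dual sc. (\<lambda>j. \<phi> (x j)) \<in> F}"

definition compatible ::
    "('k::{real_normed_field,banach} \<Rightarrow> 'a::banach \<Rightarrow> 'a) \<Rightarrow> (nat \<Rightarrow> 'k) set \<Rightarrow> ('a \<Rightarrow> 'k) \<Rightarrow> bool" where
  "compatible sc F g \<longleftrightarrow> g 0 = 0 \<and>
     (\<forall>x::nat \<Rightarrow> 'a. \<forall>a. a \<noteq> 0 \<longrightarrow>
        (\<lambda>j. g (x j)) \<notin> F \<longrightarrow> (\<lambda>j. g (sc a (x j))) \<notin> F)"

text \<open>Strong compatibility with the weak space of \<open>F\<close>; the weak space enters only through \<open>F\<close>.\<close>

definition strongly_compatible ::
    "('k::{real_normed_field,banach} \<Rightarrow> 'a::banach \<Rightarrow> 'a) \<Rightarrow> ('k \<Rightarrow> 'b::banach \<Rightarrow> 'b) \<Rightarrow>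
     (nat \<Rightarrow> 'k) set \<Rightarrow> ('a \<Rightarrow> 'b) \<Rightarrow> bool" where
  "strongly_compatible scaleX scaleY F f \<longleftrightarrow> f 0 = 0 \<and>
     (\<forall>\<phi>\<in>topological_dual scaleY. compatible scaleX F (\<phi> \<circ> f))"

definition spaceable ::
    "('k::{real_normed_field,banach} \<Rightarrow> 'a::banach \<Rightarrow> 'a) \<Rightarrow> (nat \<Rightarrow> 'a) set \<Rightarrow>
     ((nat \<Rightarrow> 'a) \<Rightarrow> real) \<Rightarrow> (nat \<Rightarrow> 'a) set \<Rightarrow> bool" where
  "spaceable sc E N A \<longleftrightarrow>
     (\<exists>V. V \<subseteq> A \<union> {0} \<and> module.subspace (seq_scale sc) V \<and>
          infinite_dimensional (seq_scale sc) V \<and>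
          closedin (quasi_norm_topology E N) V)"

definition G_weak ::
    "('k::{real_normed_field,banach} \<Rightarrow> 'b::banach \<Rightarrow> 'b) \<Rightarrow> (nat \<Rightarrow> 'a::banach) set \<Rightarrow>
     ('a \<Rightarrow> 'b) \<Rightarrow> 'l set \<Rightarrow> ('l \<Rightarrow> (nat \<Rightarrow> 'k) set) \<Rightarrow> (nat \<Rightarrow> 'a) set" where
  "G_weak scaleY E f \<Gamma> F = {x \<in> E. (\<lambda>j. f (x j)) \<notin> (\<Union>l\<in>\<Gamma>. weak_space scaleY (F l))}"

end

theory Submission
  imports Defs
begin

text \<open>
  If \<open>\<Gamma> = {}\<close>, the set is \<open>E\<close> itself, which is spaceable. Otherwise let \<open>x\<close> be one of its
  members. Sequences of finite support are carried by \<open>f\<close> into every weak space, so \<open>x\<close> has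
  infinite support and \<open>w = zero_free x\<close> has no zero coordinate. Split \<open>\<nat>\<close> into infinitely many infinite rows and let
  \<open>V\<close> consist of the elements of \<open>E\<close> whose restriction to each row is a multiple of \<open>w\<close>.

  The space \<open>V\<close> is infinite-dimensional because it contains, for each row, the copy of \<open>w\<close> carried
  by that row: removing the zeros of such a copy gives \<open>w\<close> again, so invariance puts the copy in
  \<open>E\<close>. It is closed because convergence in \<open>E\<close> implies convergence of the coordinates, and a
  coordinatewise limit of multiples of \<open>w\<close> is a multiple of \<open>w\<close>. Finally, a nonzero \<open>z \<in> V\<close> has a
  row on which it is \<open>c w\<close> with \<open>c \<noteq> 0\<close>. If \<open>f\<close> mapped \<open>z\<close> into a weak space, it would map the
  subsequence \<open>c w\<close> there by strong invariance, then \<open>w\<close> by compatibility, then \<open>x\<close> by invariance,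
  against the choice of \<open>x\<close>.

  Because \<open>V\<close> is defined by conditions on coordinates, and not as the closure of the span of the
  copies of \<open>w\<close>, no series has to be summed in the quasi-norm.
\<close>

section \<open>Removing the zeros of a sequence\<close>

text \<open>
  If \<open>g n = f k\<close> with \<open>k < n\<close>, the induction hypothesis gives \<open>g n = f k \<le> g k\<close>, against strict
  monotonicity. So \<open>k \<ge> n\<close>, and \<open>f n \<le> f k = g n\<close>.
\<close>

lemma strict_mono_le_if_range_subset:
  fixes f g :: "nat \<Rightarrow> 'a::linorder"
  assumes f: "strict_mono f" and g: "strict_mono g" and range: "range g \<subseteq> range f"
  shows "f n \<le> g n"
proof (induction n rule: less_induct)
  case (less n)
  obtain k where k: "g n = f k"
    using range by blast
  show ?case
  proof (cases "k < n")
    case True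
    with less k have "g n \<le> g k"
      by simp
    with g True show ?thesis
      by (simp add: strict_mono_less_eq)
  next
    case False
    with f k show ?thesis
      by (simp add: strict_mono_less_eq)
  qed
qed

lemma strict_mono_eq_if_range_eq:
  fixes f g :: "nat \<Rightarrow> 'a::linorder"
  assumes "strict_mono f" and "strict_mono g" and "range f = range g"
  shows "f = g"
  using assms by (intro ext antisym strict_mono_le_if_range_subset) auto

lemma enumerate_UNIV: "enumerate (UNIV :: nat set) = id"
  by (intro strict_mono_eq_if_range_eq strict_mono_enumerate)
    (auto simp: range_enumerate strict_mono_def)

lemma enumerate_strict_mono_image:
  fixes r :: "nat \<Rightarrow> nat"
  assumes r: "strict_mono r" and S: "infinite S"
  shows "enumerate (r ` S) = r \<circ> enumerate S"
proof (rule strict_mono_eq_if_range_eq)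
  have inf: "infinite (r ` S)"
    using S strict_mono_imp_inj_on[OF r] by (meson finite_imageD inj_on_subset subset_UNIV)
  then show "strict_mono (enumerate (r ` S))"
    by (rule strict_mono_enumerate)
  show "strict_mono (r \<circ> enumerate S)"
    using r strict_mono_enumerate[OF S] by (simp add: strict_mono_def)
  show "range (enumerate (r ` S)) = range (r \<circ> enumerate S)"
    by (simp only: range_enumerate[OF inf] image_comp[symmetric] range_enumerate[OF S])
qed

lemma zero_free_nonzero:
  assumes "x \<notin> c00"
  shows "zero_free x j \<noteq> 0"
  using assms enumerate_in_set[of "{j. x j \<noteq> 0}" j] by (auto simp: zero_free_def c00_def)

lemma zero_free_eq_0_iff: "zero_free x = 0 \<longleftrightarrow> x \<in> c00"
proof
  show "x \<in> c00" if "zero_free x = 0"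
    using that zero_free_nonzero[of x 0] by (auto simp: fun_eq_iff)
qed (simp add: zero_free_def c00_def zero_fun_def)

lemma zero_free_id:
  assumes "\<And>j. x j \<noteq> 0"
  shows "zero_free x = x"
  using assms by (simp add: zero_free_def enumerate_UNIV)

text \<open>
  Inserting zeros between the coordinates of a sequence does not affect its \<open>zero_free\<close> part. This
  is used for the zeros that separate the coordinates of a copy of \<open>w\<close>, and for the zeros of \<open>x\<close>,
  which remain zeros in \<open>\<phi> (f (x j))\<close>.
\<close>

lemma zero_free_comp:
  assumes r: "strict_mono r" and 0: "\<And>j. j \<notin> range r \<Longrightarrow> x j = 0"
  shows "zero_free (x \<circ> r) = zero_free x"
proof -
  let ?S = "{j. (x \<circ> r) j \<noteq> 0}"
  have supp: "{j. x j \<noteq> 0} = r ` ?S"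
    using 0 by fastforce
  then have fin: "finite {j. x j \<noteq> 0} \<longleftrightarrow> finite ?S"
    using strict_mono_imp_inj_on[OF r] by (metis finite_image_iff inj_on_subset subset_UNIV)
  show ?thesis
  proof (cases "finite ?S")
    case True
    with fin show ?thesis
      by (simp add: zero_free_def)
  next
    case False
    then have "enumerate {j. x j \<noteq> 0} = r \<circ> enumerate ?S"
      unfolding supp by (rule enumerate_strict_mono_image[OF r])
    with False fin show ?thesis
      by (simp add: zero_free_def)
  qed
qed

lemma zero_free_map_zero_free:
  assumes 0: "g 0 = 0" and x: "x \<notin> c00"
  shows "zero_free (\<lambda>j. g (zero_free x j)) = zero_free (\<lambda>j. g (x j))"
proof -
  let ?r = "enumerate {j. x j \<noteq> 0}"
  have inf: "infinite {j. x j \<noteq> 0}"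
    using x by (simp add: c00_def)
  have "(\<lambda>j. g (zero_free x j)) = (\<lambda>j. g (x j)) \<circ> ?r"
    using inf by (auto simp: zero_free_def)
  moreover have "zero_free ((\<lambda>j. g (x j)) \<circ> ?r) = zero_free (\<lambda>j. g (x j))"
    using 0 by (intro zero_free_comp strict_mono_enumerate inf) (auto simp: range_enumerate[OF inf])
  ultimately show ?thesis
    by simp
qed

lemma (in strongly_invariant_sequence_space) mem_if_zero_free_eq:
  assumes eq: "zero_free x = zero_free y" and x: "x \<in> E"
  shows "y \<in> E"
proof (cases "y \<in> c00")
  case True
  then show ?thesis
    using c00_subset by blast
next
  case False
  then have "zero_free y \<noteq> 0"
    by (simp add: zero_free_eq_0_iff)
  with eq x zero_free_invariant show ?thesis
    by metis
qed

section \<open>Membership in weak spaces\<close>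

lemma map_c00:
  assumes "g 0 = 0" and "x \<in> c00"
  shows "(\<lambda>j. g (x j)) \<in> c00"
proof -
  have "{j. g (x j) \<noteq> 0} \<subseteq> {j. x j \<noteq> 0}"
    using assms by auto
  with assms show ?thesis
    by (auto simp: c00_def intro: finite_subset)
qed

text \<open>
  This is the step that keeps the nonzero elements of \<open>V\<close> outside the weak spaces. For each
  functional separately, strong invariance passes from \<open>z\<close> to its subsequence, compatibility removes
  the factor \<open>c\<close>, and invariance puts back the zeros of \<open>x\<close>.
\<close>

lemma weak_space_if_scaled_subseq:
  assumes F: "strongly_invariant_sequence_space (*) F NF"
    and f: "strongly_compatible scaleX scaleY F f"
    and x: "x \<notin> c00" and r: "strict_mono r" and c: "c \<noteq> 0"
    and z: "\<And>m. z (r m) = scaleX c (zero_free x m)"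
    and mem: "(\<lambda>j. f (z j)) \<in> weak_space scaleY F"
  shows "(\<lambda>j. f (x j)) \<in> weak_space scaleY F"
  unfolding weak_space_def
proof (intro CollectI ballI)
  interpret F: strongly_invariant_sequence_space "(*)" F NF
    by (rule F)
  fix \<phi> assume \<phi>: "\<phi> \<in> topological_dual scaleY"
  then have comp: "compatible scaleX F (\<phi> \<circ> f)"
    using f by (simp add: strongly_compatible_def)
  have "(\<lambda>j. \<phi> (f (z j))) \<in> F"
    using mem \<phi> by (simp add: weak_space_def)
  then have "(\<lambda>j. \<phi> (f (z j))) \<circ> r \<in> F"
    using F.subseq_iff r by blast
  then have "(\<lambda>m. (\<phi> \<circ> f) (scaleX c (zero_free x m))) \<in> F"
    by (simp add: comp_def z)
  then have w: "(\<lambda>m. (\<phi> \<circ> f) (zero_free x m)) \<in> F"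
    using comp c unfolding compatible_def by blast
  have "zero_free (\<lambda>m. (\<phi> \<circ> f) (zero_free x m)) = zero_free (\<lambda>j. (\<phi> \<circ> f) (x j))"
    using comp x by (intro zero_free_map_zero_free) (auto simp: compatible_def)
  then have "(\<lambda>j. (\<phi> \<circ> f) (x j)) \<in> F"
    using w by (rule F.mem_if_zero_free_eq)
  then show "(\<lambda>j. \<phi> (f (x j))) \<in> F"
    by simp
qed

lemma weak_space_if_c00:
  assumes F: "strongly_invariant_sequence_space (*) F NF"
    and f: "strongly_compatible scaleX scaleY F f" and x: "x \<in> c00"
  shows "(\<lambda>j. f (x j)) \<in> weak_space scaleY F"
  unfolding weak_space_def
proof (intro CollectI ballI)
  fix \<phi> assume "\<phi> \<in> topological_dual scaleY"
  then have "(\<phi> \<circ> f) 0 = 0"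
    using f unfolding strongly_compatible_def compatible_def by blast
  then have "(\<lambda>j. (\<phi> \<circ> f) (x j)) \<in> c00"
    using x by (rule map_c00)
  then show "(\<lambda>j. \<phi> (f (x j))) \<in> F"
    using strongly_invariant_sequence_space.c00_subset[OF F] by (auto simp: comp_def)
qed

section \<open>Infinite-dimensional and closed spaces of sequences\<close>

lemma (in vector_space) vector_space_seq_scale: "vector_space (seq_scale scale)"
  by standard (auto simp: seq_scale_def scale_right_distrib scale_left_distrib fun_eq_iff)

text \<open>
  With a pivot coordinate for each member of an infinite family, at which all the other members
  vanish, the family is linearly independent: a member cannot be in the span of the others because
  these lie in the hyperplane where its pivot coordinate vanishes.
\<close>

lemma (in vector_space) infinite_dimensional_if_pivots:
  fixes y :: "nat \<Rightarrow> nat \<Rightarrow> 'b"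
  assumes y: "\<And>i. y i \<in> V" and pivot: "\<And>i j. y j (p i) = 0 \<longleftrightarrow> j \<noteq> i"
  shows "infinite_dimensional (seq_scale scale) V"
  unfolding infinite_dimensional_def
proof
  interpret S: vector_space "seq_scale scale"
    by (rule vector_space_seq_scale)
  assume "\<exists>B. finite B \<and> S.span B = V"
  then obtain B where B: "finite B" "S.span B = V"
    by blast
  have "y i \<notin> S.span (range y - {y i})" for i
  proof
    have "S.subspace {z. z (p i) = 0}"
      by (rule S.subspaceI) (auto simp: seq_scale_def)
    moreover have "range y - {y i} \<subseteq> {z. z (p i) = 0}"
      using pivot by fastforce
    ultimately have "S.span (range y - {y i}) \<subseteq> {z. z (p i) = 0}"
      by (intro S.span_minimal)
    moreover assume "y i \<in> S.span (range y - {y i})"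
    ultimately show False
      using pivot by blast
  qed
  then have "\<not> S.dependent (range y)"
    by (auto simp: S.dependent_def)
  moreover have "range y \<subseteq> S.span B"
    using y B by auto
  ultimately have "finite (range y)"
    using S.independent_span_bound B by blast
  moreover have "inj y"
    using pivot by (metis injI)
  ultimately show False
    using finite_imageD by fastforce
qed

lemma topspace_quasi_norm_topology: "topspace (quasi_norm_topology E N) = E"
proof
  show "topspace (quasi_norm_topology E N) \<subseteq> E"
    using openin_topspace by (metis openin_quasi_norm_topology)
  have "openin (quasi_norm_topology E N) E"
    by (auto simp: openin_quasi_norm_topology intro: exI[of _ 1])
  then show "E \<subseteq> topspace (quasi_norm_topology E N)"
    by (rule openin_subset)
qed

text \<open>
  Sequences suffice here although \<open>{y. N (y - z) < e}\<close> need not be open: a point of \<open>E - V\<close> at which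
  \<open>E - V\<close> fails the defining condition of openness for every radius is a limit of points of \<open>V\<close>.
\<close>

lemma closedin_quasi_norm_topologyI:
  assumes V: "V \<subseteq> E"
    and lim: "\<And>u z. (\<And>n. u n \<in> V) \<Longrightarrow> z \<in> E \<Longrightarrow> (\<lambda>n. N (u n - z)) \<longlonglongrightarrow> 0 \<Longrightarrow> z \<in> V"
    and nonneg: "\<And>u z. u \<in> V \<Longrightarrow> z \<in> E \<Longrightarrow> 0 \<le> N (u - z)"
  shows "closedin (quasi_norm_topology E N) V"
proof -
  have "openin (quasi_norm_topology E N) (E - V)"
    unfolding openin_quasi_norm_topology
  proof (intro conjI ballI)
    fix z assume z: "z \<in> E - V"
    show "\<exists>e>0. \<forall>y\<in>E. N (y - z) < e \<longrightarrow> y \<in> E - V"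
    proof (rule ccontr)
      assume "\<not> ?thesis"
      then have "\<exists>y\<in>V. N (y - z) < inverse (real (Suc n))" for n
        by (metis DiffI inverse_positive_iff_positive of_nat_0_less_iff zero_less_Suc)
      then obtain u where u: "\<And>n. u n \<in> V" "\<And>n. N (u n - z) < inverse (real (Suc n))"
        by metis
      have "(\<lambda>n. N (u n - z)) \<longlonglongrightarrow> 0"
        using u z nonneg by (intro tendsto_sandwich[OF _ _ tendsto_const LIMSEQ_inverse_real_of_nat])
          (auto intro!: always_eventually less_imp_le)
      with u z lim show False
        by blast
    qed
  qed auto
  with V show ?thesis
    by (simp add: closedin_def topspace_quasi_norm_topology)
qed

text \<open>
  The coefficients are controlled by the coordinate where \<open>w\<close> does not vanish, so they form a Cauchy
  sequence, and the scalar field is complete.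
\<close>

lemma (in banach_space_over) tendsto_multiples:
  assumes w: "w p \<noteq> 0" and lim: "\<And>m. (\<lambda>n. sc (c n) (w m)) \<longlonglongrightarrow> v m"
  shows "\<exists>c. \<forall>m. v m = sc c (w m)"
proof -
  have dist: "norm (sc a x - sc b x) = norm (a - b) * norm x" for a b x
    by (simp add: scale_left_diff_distrib[symmetric] norm_scale)
  have "Cauchy c"
  proof (rule metric_CauchyI)
    fix e :: real assume "e > 0"
    then have "e * norm (w p) > 0"
      using w by simp
    moreover have "Cauchy (\<lambda>n. sc (c n) (w p))"
      using lim by (rule LIMSEQ_imp_Cauchy)
    ultimately obtain M where "\<forall>m\<ge>M. \<forall>n\<ge>M. dist (sc (c m) (w p)) (sc (c n) (w p)) < e * norm (w p)"
      by (meson metric_CauchyD)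
    then show "\<exists>M. \<forall>m\<ge>M. \<forall>n\<ge>M. dist (c m) (c n) < e"
      using w by (auto simp: dist_norm dist)
  qed
  then obtain a where a: "c \<longlonglongrightarrow> a"
    by (auto simp: Cauchy_convergent_iff convergent_def)
  have "v m = sc a (w m)" for m
  proof (rule LIMSEQ_unique[OF lim])
    have "(\<lambda>n. norm (c n - a) * norm (w m)) \<longlonglongrightarrow> 0"
      using a by (auto intro!: tendsto_mult_left_zero simp: tendsto_norm_zero_iff LIM_zero_iff)
    then have "(\<lambda>n. sc (c n) (w m) - sc a (w m)) \<longlonglongrightarrow> 0"
      by (subst tendsto_norm_zero_iff[symmetric]) (simp add: dist)
    then show "(\<lambda>n. sc (c n) (w m)) \<longlonglongrightarrow> sc a (w m)"
      by (rule LIM_zero_cancel)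
  qed
  then show ?thesis
    by blast
qed

lemma (in invariant_sequence_space) tendsto_coordinate:
  assumes u: "\<And>n. u n \<in> E" and z: "z \<in> E" and lim: "(\<lambda>n. N (u n - z)) \<longlonglongrightarrow> 0"
  shows "(\<lambda>n. u n j) \<longlonglongrightarrow> z j"
proof -
  interpret X: banach_space_over sc
    by (rule base_space)
  interpret S: vector_space "seq_scale sc"
    by (rule X.vector_space_seq_scale)
  have "u n - z \<in> E" for n
    using u z linear_subspace by (intro S.subspace_diff)
  then have "norm (u n j - z j) \<le> N (u n - z)" for n
    using coordinate_le[of "u n - z" j] by simp
  then have "(\<lambda>n. u n j - z j) \<longlonglongrightarrow> 0"
    by (intro Lim_null_comparison[OF _ lim]) auto
  then show ?thesis
    by (rule LIM_zero_cancel)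
qed

section \<open>Sequences that are multiples of a given one on each row\<close>

lemma strict_mono_prod_encode: "strict_mono (\<lambda>m. prod_encode (i, m))"
  by (rule strict_mono_Suc_iff[THEN iffD2]) (simp add: prod_encode_def)

text \<open>
  Row \<open>i\<close> of \<open>\<nat>\<close> consists of the numbers \<open>prod_encode (i, m)\<close>. They increase with \<open>m\<close>, so the
  restriction of a sequence to a row is a subsequence of it.
\<close>

definition row_multiples :: "('k \<Rightarrow> 'a \<Rightarrow> 'a) \<Rightarrow> (nat \<Rightarrow> 'a) \<Rightarrow> (nat \<Rightarrow> 'a) set" where
  "row_multiples sc w = {z. \<forall>i. \<exists>c. \<forall>m. z (prod_encode (i, m)) = sc c (w m)}"

definition row_copy :: "(nat \<Rightarrow> 'a::zero) \<Rightarrow> nat \<Rightarrow> nat \<Rightarrow> 'a" where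
  "row_copy w i j = (if fst (prod_decode j) = i then w (snd (prod_decode j)) else 0)"

lemma row_copy_prod_encode: "row_copy w i (prod_encode (k, m)) = (if k = i then w m else 0)"
  by (simp add: row_copy_def)

lemma zero_free_row_copy: "zero_free (row_copy w i) = zero_free w"
proof -
  have "row_copy w i j = 0" if "j \<notin> range (\<lambda>m. prod_encode (i, m))" for j
    using that by (metis prod_decode_inverse prod.collapse rangeI row_copy_def)
  then have "zero_free (row_copy w i \<circ> (\<lambda>m. prod_encode (i, m))) = zero_free (row_copy w i)"
    by (intro zero_free_comp strict_mono_prod_encode) auto
  then show ?thesis
    by (simp add: comp_def row_copy_prod_encode)
qed

lemma (in vector_space) subspace_row_multiples:
  "module.subspace (seq_scale scale) (row_multiples scale w)"
proof -
  interpret S: vector_space "seq_scale scale"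
    by (rule vector_space_seq_scale)
  show ?thesis
  proof (rule S.subspaceI)
    show "0 \<in> row_multiples scale w"
      by (auto simp: row_multiples_def intro: exI[of _ 0])
    show "y + z \<in> row_multiples scale w"
      if yz: "y \<in> row_multiples scale w" "z \<in> row_multiples scale w" for y z
      unfolding row_multiples_def
    proof (intro CollectI allI)
      fix i
      obtain a b where "\<forall>m. y (prod_encode (i, m)) = scale a (w m)"
        "\<forall>m. z (prod_encode (i, m)) = scale b (w m)"
        using yz unfolding row_multiples_def by blast
      then show "\<exists>c. \<forall>m. (y + z) (prod_encode (i, m)) = scale c (w m)"
        by (intro exI[of _ "a + b"]) (simp add: scale_left_distrib)
    qed
    show "seq_scale scale c z \<in> row_multiples scale w" if z: "z \<in> row_multiples scale w" for c z
      unfolding row_multiples_def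
    proof (intro CollectI allI)
      fix i
      obtain a where "\<forall>m. z (prod_encode (i, m)) = scale a (w m)"
        using z unfolding row_multiples_def by blast
      then show "\<exists>c'. \<forall>m. seq_scale scale c z (prod_encode (i, m)) = scale c' (w m)"
        by (intro exI[of _ "c * a"]) (simp add: seq_scale_def)
    qed
  qed
qed

lemma (in banach_space_over) row_multiples_nonzero_row:
  assumes z: "z \<in> row_multiples sc w" and "z \<noteq> 0"
  shows "\<exists>i c. c \<noteq> 0 \<and> (\<forall>m. z (prod_encode (i, m)) = sc c (w m))"
proof -
  obtain j where j: "z j \<noteq> 0"
    using \<open>z \<noteq> 0\<close> by (auto simp: fun_eq_iff)
  obtain i m where im: "j = prod_encode (i, m)"
    by (metis prod_decode_inverse surj_pair)
  obtain c where c: "\<forall>m. z (prod_encode (i, m)) = sc c (w m)"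
    using z unfolding row_multiples_def by blast
  have "c \<noteq> 0"
    using c im j by auto
  with c show ?thesis
    by blast
qed

context invariant_sequence_space
begin

lemma closedin_row_multiples:
  assumes "w p \<noteq> 0"
  shows "closedin (quasi_norm_topology E N) (E \<inter> row_multiples sc w)"
proof (rule closedin_quasi_norm_topologyI)
  interpret X: banach_space_over sc
    by (rule base_space)
  interpret S: vector_space "seq_scale sc"
    by (rule X.vector_space_seq_scale)
  show "0 \<le> N (u - z)" if "u \<in> E \<inter> row_multiples sc w" "z \<in> E" for u z
    using that linear_subspace by (intro nonneg S.subspace_diff) auto
  fix u z
  assume u: "\<And>n. u n \<in> E \<inter> row_multiples sc w" and z: "z \<in> E"
    and lim: "(\<lambda>n. N (u n - z)) \<longlonglongrightarrow> 0"
  have "\<exists>c. \<forall>m. z (prod_encode (i, m)) = sc c (w m)" for i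
  proof -
    have "\<forall>n. \<exists>c. \<forall>m. u n (prod_encode (i, m)) = sc c (w m)"
      using u unfolding row_multiples_def by blast
    then obtain c where c: "\<And>n m. u n (prod_encode (i, m)) = sc (c n) (w m)"
      by metis
    have "(\<lambda>n. sc (c n) (w m)) \<longlonglongrightarrow> z (prod_encode (i, m))" for m
      using tendsto_coordinate[of u z "prod_encode (i, m)"] u z lim by (simp add: c)
    then show ?thesis
      using assms by (intro X.tendsto_multiples)
  qed
  then show "z \<in> E \<inter> row_multiples sc w"
    using z by (simp add: row_multiples_def)
qed simp

lemma infinite_dimensional_row_multiples:
  assumes w: "w \<in> E" and nonzero: "\<And>j. w j \<noteq> 0"
  shows "infinite_dimensional (seq_scale sc) (E \<inter> row_multiples sc w)"
proof -
  interpret X: banach_space_over sc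
    by (rule base_space)
  show ?thesis
  proof (rule X.infinite_dimensional_if_pivots)
    fix i
    have "zero_free (row_copy w i) = w"
      using nonzero by (simp add: zero_free_row_copy zero_free_id)
    moreover have "w \<noteq> 0"
      using nonzero by (auto simp: fun_eq_iff)
    ultimately have "row_copy w i \<in> E"
      using zero_free_invariant w by metis
    moreover have "row_copy w i \<in> row_multiples sc w"
      unfolding row_multiples_def
    proof (intro CollectI allI)
      show "\<exists>c. \<forall>m. row_copy w i (prod_encode (k, m)) = sc c (w m)" for k
        by (rule exI[of _ "if k = i then 1 else 0"]) (simp add: row_copy_prod_encode)
    qed
    ultimately show "row_copy w i \<in> E \<inter> row_multiples sc w"
      by simp
    show "row_copy w j (prod_encode (i, 0)) = 0 \<longleftrightarrow> j \<noteq> i" for j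
      using nonzero by (auto simp: row_copy_prod_encode)
  qed
qed

lemma spaceable_if_row_multiples_subset:
  assumes w: "w \<in> E" and nonzero: "\<And>j. w j \<noteq> 0"
    and subset: "E \<inter> row_multiples sc w \<subseteq> A \<union> {0}"
  shows "spaceable sc E N A"
proof -
  interpret X: banach_space_over sc
    by (rule base_space)
  interpret S: vector_space "seq_scale sc"
    by (rule X.vector_space_seq_scale)
  show ?thesis
    unfolding spaceable_def
  proof (intro exI conjI)
    show "S.subspace (E \<inter> row_multiples sc w)"
      by (intro S.subspace_inter linear_subspace X.subspace_row_multiples)
    show "infinite_dimensional (seq_scale sc) (E \<inter> row_multiples sc w)"
      using w nonzero by (rule infinite_dimensional_row_multiples)
    show "closedin (quasi_norm_topology E N) (E \<inter> row_multiples sc w)"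
      using nonzero by (rule closedin_row_multiples)
  qed (rule subset)
qed

lemma spaceable_whole_space: "spaceable sc E N E"
  unfolding spaceable_def
proof (intro exI conjI)
  show "closedin (quasi_norm_topology E N) E"
    by (metis closedin_topspace topspace_quasi_norm_topology)
qed (use linear_subspace infinite_dim in auto)

end

section \<open>The spaceability theorem\<close>

theorem theorem3p6:
  fixes scaleX :: "'k::{real_normed_field,banach} \<Rightarrow> 'a::banach \<Rightarrow> 'a"
    and scaleY :: "'k \<Rightarrow> 'b::banach \<Rightarrow> 'b"
    and E :: "(nat \<Rightarrow> 'a) set" and N :: "(nat \<Rightarrow> 'a) \<Rightarrow> real"
    and \<Gamma> :: "'l set"
    and F :: "'l \<Rightarrow> (nat \<Rightarrow> 'k) set" and NF :: "'l \<Rightarrow> (nat \<Rightarrow> 'k) \<Rightarrow> real"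
    and f :: "'a \<Rightarrow> 'b"
  assumes "banach_space_over scaleX"
    and "banach_space_over scaleY"
    and "invariant_sequence_space scaleX E N"
    and "\<And>l. l \<in> \<Gamma> \<Longrightarrow> strongly_invariant_sequence_space (*) (F l) (NF l)"
    and "\<And>l. l \<in> \<Gamma> \<Longrightarrow> strongly_compatible scaleX scaleY (F l) f"
  shows "G_weak scaleY E f \<Gamma> F = {} \<or> spaceable scaleX E N (G_weak scaleY E f \<Gamma> F)"
proof -
  interpret X: banach_space_over scaleX
    by fact
  interpret E: invariant_sequence_space scaleX E N
    by fact
  let ?G = "G_weak scaleY E f \<Gamma> F"
  have "spaceable scaleX E N ?G" if \<Gamma>: "\<Gamma> \<noteq> {}" and x: "x \<in> ?G" for x
  proof -
    have xE: "x \<in> E" and notin: "\<And>l. l \<in> \<Gamma> \<Longrightarrow> (\<lambda>j. f (x j)) \<notin> weak_space scaleY (F l)"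
      using x by (auto simp: G_weak_def)
    have inf: "x \<notin> c00"
      using \<Gamma> notin weak_space_if_c00 assms(4,5) by blast
    then have "zero_free x \<noteq> 0"
      by (simp add: zero_free_eq_0_iff)
    then have "zero_free x \<in> E"
      using E.zero_free_invariant xE by blast
    moreover have "E \<inter> row_multiples scaleX (zero_free x) \<subseteq> ?G \<union> {0}"
    proof
      fix z assume z: "z \<in> E \<inter> row_multiples scaleX (zero_free x)"
      have "(\<lambda>j. f (z j)) \<notin> weak_space scaleY (F l)" if l: "l \<in> \<Gamma>" and "z \<noteq> 0" for l
      proof
        assume mem: "(\<lambda>j. f (z j)) \<in> weak_space scaleY (F l)"
        obtain i c where c: "c \<noteq> 0"
          and row: "\<And>m. z (prod_encode (i, m)) = scaleX c (zero_free x m)"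
          using X.row_multiples_nonzero_row z \<open>z \<noteq> 0\<close> by blast
        have "(\<lambda>j. f (x j)) \<in> weak_space scaleY (F l)"
          by (rule weak_space_if_scaled_subseq
              [OF assms(4)[OF l] assms(5)[OF l] inf strict_mono_prod_encode c row mem])
        with notin l show False
          by blast
      qed
      with z show "z \<in> ?G \<union> {0}"
        by (auto simp: G_weak_def)
    qed
    ultimately show ?thesis
      using zero_free_nonzero[OF inf] by (intro E.spaceable_if_row_multiples_subset)
  qed
  moreover have "spaceable scaleX E N ?G" if "\<Gamma> = {}"
    using E.spaceable_whole_space that by (simp add: G_weak_def)
  ultimately show ?thesis
    by blast
qed

end
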